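(* Let $p,q\ge1$ be integers and $\sigma_1,\sigma_2\in\{\pm1\}$ with $(q,\sigma_2)\ne(1,1)$. The linear Euler $T$-sums $T_{p,q}^{\sigma_1,\sigma_2}$ and $\tilde S$-sums $\tilde S_{p,q}^{\sigma_1,\sigma_2}$ are expressible in terms of colored multiple zeta values of weight $p+q$ and level four: \begin{align*} T_{p,q}^{\sigma_1,\sigma_2}=2^{p+q-2}\sigma_1^{3/2}\sigma_2^{3/2}\big\{ &L_4(q,p;\lambda_{\sigma_2},\lambda_{\sigma_1})-L_4(q,p;\lambda_{\sigma_2},\lambda_{\sigma_1}+2)\\ &-L_4(q,p;\lambda_{\sigma_2}+2,\lambda_{\sigma_1})+L_4(q,p;\lambda_{\sigma_2}+2,\lambda_{\sigma_1}+2)\big\} \end{align*} and \begin{align*} \tilde S_{p,q}^{\sigma_1,\sigma_2}=2^{p+q-2}\sigma_1^{3/2}\sigma_2\big\{ &L_4(q,p;\lambda_{\sigma_2},\lambda_{\sigma_1})-L_4(q,p;\lambda_{\sigma_2},\lambda_{\sigma_1}+2)\\ &+L_4(q,p;\lambda_{\sigma_2}+2,\lambda_{\sigma_1})-L_4(q,p;\lambda_{\sigma_2}+2,\lambda_{\sigma_1}+2)\big\}, \end{align*} where $\lambda_{\sigma}=0$ if $\sigma=1$ and $\lambda_{\sigma}=1$ if $\sigma=-1$. In case $q=1$ and $\sigma_2=-1$ the double series are understood as limits of partial sums over the outer index.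
   Context: For $\sigma\in\{\pm1\}$, $n\ge0$, $r\ge1$: $h_n^{(r)}(\sigma)=\sum_{k=1}^n\frac{\sigma^{k-1}}{(k-1/2)^r}$. The sums are $T_{p,q}^{\sigma_1,\sigma_2}=\sum_{n\ge1}\sigma_2^{n-1}\frac{h_{n-1}^{(p)}(\sigma_1)}{(n-1/2)^q}$ and $\tilde S_{p,q}^{\sigma_1,\sigma_2}=\sum_{n\ge1}\sigma_2^{n-1}\frac{h_n^{(p)}(\sigma_1)}{n^q}$. With $\omega=\exp(2\pi\mathrm{i}/4)=\mathrm{i}$, $L_4(s_1,s_2;r_1,r_2)=\sum_{n_1>n_2\ge1}\frac{\omega^{r_1n_1}\omega^{r_2n_2}}{n_1^{s_1}n_2^{s_2}}$ denotes the colored multiple zeta values of level four (with the convention that $L_4$ requires $(s_1,\omega^{r_1})\ne(1,1)$). The powers are taken with $\sigma=\exp(\lambda_\sigma\pi\mathrm{i})$, i.e. $\sigma^{3/2}=\exp(3\lambda_\sigma\pi\mathrm{i}/2)$, so $1^{3/2}=1$ and $(-1)^{3/2}=-\mathrm{i}$. *)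

theory Defs
  imports Complex_Main
begin

definition h_sum :: "nat \<Rightarrow> nat \<Rightarrow> int \<Rightarrow> real" where
  "h_sum n r \<sigma> = (\<Sum>k=1..n. of_int \<sigma> ^ (k - 1) / (real k - 1/2) ^ r)"

definition T_term :: "nat \<Rightarrow> nat \<Rightarrow> int \<Rightarrow> int \<Rightarrow> nat \<Rightarrow> real" where
  "T_term p q \<sigma>1 \<sigma>2 n = of_int \<sigma>2 ^ (n - 1) * h_sum (n - 1) p \<sigma>1 / (real n - 1/2) ^ q"

definition S_term :: "nat \<Rightarrow> nat \<Rightarrow> int \<Rightarrow> int \<Rightarrow> nat \<Rightarrow> real" where
  "S_term p q \<sigma>1 \<sigma>2 n = of_int \<sigma>2 ^ (n - 1) * h_sum n p \<sigma>1 / real n ^ q"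

text \<open>All the series start at index 1, hence the shifts by \<^const>\<open>Suc\<close> below.\<close>

definition T_sum :: "nat \<Rightarrow> nat \<Rightarrow> int \<Rightarrow> int \<Rightarrow> real" where
  "T_sum p q \<sigma>1 \<sigma>2 = (\<Sum>n. T_term p q \<sigma>1 \<sigma>2 (Suc n))"

definition S_sum :: "nat \<Rightarrow> nat \<Rightarrow> int \<Rightarrow> int \<Rightarrow> real" where
  "S_sum p q \<sigma>1 \<sigma>2 = (\<Sum>n. S_term p q \<sigma>1 \<sigma>2 (Suc n))"

definition omega4 :: complex where
  "omega4 = exp (2 * of_real pi * \<i> / 4)"

text \<open>
  The double series over \<open>n1 > n2 \<ge> 1\<close> is summed as the limit of the partial sums over the
  outer index \<open>n1\<close>. For \<open>s1 \<ge> 2\<close> and \<open>s2 \<ge> 1\<close> it converges absolutely, so the order of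
  summation matters only for \<open>s1 = 1\<close>.
\<close>

definition L4_term :: "nat \<Rightarrow> nat \<Rightarrow> nat \<Rightarrow> nat \<Rightarrow> nat \<Rightarrow> complex" where
  "L4_term s1 s2 r1 r2 n1 =
     (\<Sum>n2=1..<n1. omega4 ^ (r1 * n1) * omega4 ^ (r2 * n2) / (of_nat n1 ^ s1 * of_nat n2 ^ s2))"

definition L4 :: "nat \<Rightarrow> nat \<Rightarrow> nat \<Rightarrow> nat \<Rightarrow> complex" where
  "L4 s1 s2 r1 r2 = (\<Sum>n. L4_term s1 s2 r1 r2 (Suc n))"

definition lam :: "int \<Rightarrow> nat" where
  "lam \<sigma> = (if \<sigma> = 1 then 0 else 1)"

text \<open>
  The power \<open>\<sigma>\<^sup>a\<close> of a sign \<open>\<sigma> \<in> {1, -1}\<close>, on the branch \<open>\<sigma> = exp (lam \<sigma> * pi * \<i>)\<close>.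
\<close>

definition sign_powr :: "int \<Rightarrow> real \<Rightarrow> complex" where
  "sign_powr \<sigma> a = exp (of_real a * of_nat (lam \<sigma>) * of_real pi * \<i>)"

end

theory Submission
  imports Defs "HOL-Analysis.Analysis"
begin

text \<open>
  Split the level-four sums by the parity of the two indices: replacing \<open>r\<close> by \<open>r + 2\<close> multiplies
  the \<open>n\<close>-th term by \<open>(-1) ^ n\<close>, so the four-term combinations keep only odd inner indices
  \<open>n2 = 2 k - 1\<close> and only odd (for \<open>T\<close>) or only even (for \<open>S\<close>) outer indices. Convergence of the
  level-four series follows from \<open>\<Sum>k<n. 1/k \<le> 3 \<surd>n\<close>, by comparison if \<open>q \<ge> 2\<close> and by Dirichlet's
  test if \<open>q = 1\<close>; convergence of the other two series follows by grouping consecutive terms.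
\<close>

section \<open>Summation by parts and Dirichlet's test\<close>

lemma summation_by_parts:
  fixes z a :: "nat \<Rightarrow> 'a::comm_ring_1"
  shows "(\<Sum>k<n. z k * a k) = (\<Sum>k<n. z k) * a n - (\<Sum>k<n. (\<Sum>j<Suc k. z j) * (a (Suc k) - a k))"
  by (induction n) (simp_all add: algebra_simps)

text \<open>Bounded variation replaces the usual monotonicity because the test is applied to complex
  coefficients. After summation by parts the boundary term tends to 0 and the remaining series is
  dominated by \<open>C\<close> times the variation of \<open>a\<close>.\<close>

lemma Dirichlet_summable:
  fixes z a :: "nat \<Rightarrow> complex"
  assumes bound: "\<And>n. norm (\<Sum>k<n. z k) \<le> C"
    and null: "a \<longlonglongrightarrow> 0"
    and bv: "summable (\<lambda>n. norm (a (Suc n) - a n))"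
  shows "summable (\<lambda>n. z n * a n)"
proof -
  have "(\<lambda>n. (\<Sum>k<n. z k) * a n) \<longlonglongrightarrow> 0"
  proof (rule Lim_null_comparison)
    show "\<forall>\<^sub>F n in sequentially. norm ((\<Sum>k<n. z k) * a n) \<le> C * norm (a n)"
      using bound by (simp add: norm_mult mult_right_mono)
    show "(\<lambda>n. C * norm (a n)) \<longlonglongrightarrow> 0"
      using tendsto_mult_right_zero[OF tendsto_norm_zero[OF null]] .
  qed
  moreover have "summable (\<lambda>k. (\<Sum>j<Suc k. z j) * (a (Suc k) - a k))"
  proof (rule summable_comparison_test')
    show "summable (\<lambda>k. C * norm (a (Suc k) - a k))"
      by (intro summable_mult bv)
    show "norm ((\<Sum>j<Suc k. z j) * (a (Suc k) - a k)) \<le> C * norm (a (Suc k) - a k)"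
      if "k \<ge> 0" for k
      unfolding norm_mult by (intro mult_right_mono bound norm_ge_zero)
  qed
  ultimately have "convergent (\<lambda>n. \<Sum>k<n. z k * a k)"
    unfolding summable_iff_convergent
    by (subst summation_by_parts) (intro convergent_diff, auto simp: convergent_def)
  then show ?thesis
    by (simp add: summable_iff_convergent)
qed

lemma norm_sum_powers_le:
  fixes w :: complex
  assumes "norm w = 1" "w \<noteq> 1"
  shows "norm (\<Sum>k<n. w ^ Suc k) \<le> 2 / norm (1 - w)"
proof -
  have "(\<Sum>k<n. w ^ Suc k) = w * ((1 - w ^ n) / (1 - w))"
    using assms(2) by (simp add: sum_gp_strict flip: sum_distrib_left)
  moreover have "norm (1 - w ^ n) \<le> 2"
    using norm_triangle_ineq4[of 1 "w ^ n"] assms(1) by (simp add: norm_power)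
  ultimately show ?thesis
    using assms by (simp add: norm_mult norm_divide divide_right_mono)
qed

section \<open>Growth of the inner sums and convergence of the double series\<close>

text \<open>The difference of roots is the reciprocal of \<open>sqrt (x + 1) + sqrt x\<close>, which
  is at most \<open>2 * x + x\<close> for \<open>x \<ge> 1\<close>. The right-hand side telescopes
  when summed.\<close>

lemma inverse_le_sqrt_diff:
  fixes x :: real
  assumes "x \<ge> 1"
  shows "1 / x \<le> 3 * (sqrt (x + 1) - sqrt x)"
proof -
  have "x * 1 \<le> x * x"
    using assms by (intro mult_left_mono) auto
  then have "x \<le> x\<^sup>2" "x + 1 \<le> 2\<^sup>2 * x\<^sup>2"
    unfolding power2_eq_square using assms by linarith+
  then have "sqrt x \<le> x" "sqrt (x + 1) \<le> 2 * x"
    using assms by (auto intro!: real_le_lsqrt simp: power_mult_distrib)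
  then have le: "sqrt (x + 1) + sqrt x \<le> 3 * x"
    by linarith
  have pos: "sqrt (x + 1) + sqrt x > 0"
    using assms by (intro add_pos_pos) auto
  have "(sqrt (x + 1) - sqrt x) * (sqrt (x + 1) + sqrt x) = 1"
    using assms by (simp add: algebra_simps)
  then have "sqrt (x + 1) - sqrt x = 1 / (sqrt (x + 1) + sqrt x)"
    using pos by (simp add: field_simps)
  moreover have "1 / (sqrt (x + 1) + sqrt x) \<ge> 1 / (3 * x)"
    using le pos assms by (intro divide_left_mono) auto
  ultimately show ?thesis
    by simp
qed

text \<open>Each new term is at most the reciprocal of its index, hence at most the increment of
  \<open>3 * sqrt\<close>. The square root is a crude bound, but division by the squared index still
  leaves a summable sequence.\<close>

lemma norm_sum_divide_power_le:
  fixes v :: complex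
  assumes "norm v = 1" "p \<ge> 1"
  shows "norm (\<Sum>k=1..<Suc n. v ^ k / of_nat k ^ p) \<le> 3 * sqrt (real (Suc n))"
proof (induction n)
  case 0
  then show ?case by simp
next
  case (Suc n)
  let ?x = "real (Suc n)"
  have "norm (v ^ Suc n / of_nat (Suc n) ^ p) = 1 / ?x ^ p"
    using assms(1) by (simp only: norm_divide norm_power norm_of_nat power_one)
  also have "\<dots> \<le> 1 / ?x ^ 1"
    using assms(2) by (intro divide_left_mono power_increasing) auto
  also have "1 / ?x ^ 1 \<le> 3 * (sqrt (?x + 1) - sqrt ?x)"
    using inverse_le_sqrt_diff[of ?x] by simp
  finally have "norm (v ^ Suc n / of_nat (Suc n) ^ p) \<le> 3 * (sqrt (?x + 1) - sqrt ?x)" .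
  moreover have "(\<Sum>k=1..<Suc (Suc n). v ^ k / of_nat k ^ p)
      = (\<Sum>k=1..<Suc n. v ^ k / of_nat k ^ p) + v ^ Suc n / of_nat (Suc n) ^ p"
    by (subst sum.atLeastLessThan_Suc) auto
  moreover have "real (Suc (Suc n)) = ?x + 1"
    by simp
  ultimately show ?case
    using Suc.IH norm_triangle_ineq[of "\<Sum>k=1..<Suc n. v ^ k / of_nat k ^ p"
        "v ^ Suc n / of_nat (Suc n) ^ p"]
    by (simp only:) argo
qed

text \<open>This is the common majorant: for the terms themselves if \<open>q \<ge> 2\<close>, and
  for the variation of the coefficients if \<open>q = 1\<close>.\<close>

lemma summable_sqrt_over_square: "summable (\<lambda>n. sqrt (real (Suc n)) / real (Suc n) ^ 2)"
proof -
  have "summable (\<lambda>n. real (Suc n) powr (-3/2))"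
    by (subst summable_Suc_iff) (simp add: summable_real_powr_iff)
  moreover have "real (Suc n) powr (-3/2) = sqrt (real (Suc n)) / real (Suc n) ^ 2" for n
  proof -
    have "real (Suc n) powr (-3/2) = real (Suc n) powr (1/2 - 2)"
      by simp
    also have "\<dots> = sqrt (real (Suc n)) / real (Suc n) ^ 2"
      unfolding powr_diff by (simp add: powr_half_sqrt powr_numeral)
    finally show ?thesis .
  qed
  ultimately show ?thesis
    by simp
qed

lemma summable_double_power_sum:
  fixes v w :: complex
  assumes v: "norm v = 1" and w: "norm w = 1" and p: "p \<ge> 1" and q: "q \<ge> 1"
    and conv: "q = 1 \<Longrightarrow> w \<noteq> 1"
  shows "summable (\<lambda>n. w ^ Suc n * ((\<Sum>k=1..<Suc n. v ^ k / of_nat k ^ p) / of_nat (Suc n) ^ q))"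
proof -
  define H where "H n = (\<Sum>k=1..<Suc n. v ^ k / of_nat k ^ p)" for n
  have H_le: "norm (H n) \<le> 3 * sqrt (real (Suc n))" for n
    unfolding H_def by (rule norm_sum_divide_power_le[OF v p])
  have "summable (\<lambda>n. w ^ Suc n * (H n / of_nat (Suc n) ^ q))"
  proof (cases "q = 1")
    case True
    define a where "a n = H n / of_nat (Suc n)" for n
    have norm_a: "norm (a n) \<le> 3 * (sqrt (real (Suc n)) / real (Suc n))" for n
      using divide_right_mono[OF H_le, of "real (Suc n)" n]
      by (simp add: a_def norm_divide del: of_nat_Suc)
    have "summable (\<lambda>n. w ^ Suc n * a n)"
    proof (rule Dirichlet_summable)
      show "norm (\<Sum>k<n. w ^ Suc k) \<le> 2 / norm (1 - w)" for n
        using conv[OF True] w by (intro norm_sum_powers_le)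
      have "(\<lambda>n. 3 * (sqrt (real (Suc n)) / real (Suc n))) \<longlonglongrightarrow> 0"
      proof -
        have "(\<lambda>n. 3 / sqrt (real (Suc n))) \<longlonglongrightarrow> 0"
          by (intro tendsto_divide_0[OF tendsto_const] filterlim_at_top_imp_at_infinity
              filterlim_compose[OF sqrt_at_top]
              filterlim_compose[OF filterlim_real_sequentially filterlim_Suc])
        moreover have "3 / sqrt (real (Suc n)) = 3 * (sqrt (real (Suc n)) / real (Suc n))" for n
          by (simp add: sqrt_divide_self_eq inverse_eq_divide del: of_nat_Suc)
        ultimately show ?thesis
          by simp
      qed
      then show "a \<longlonglongrightarrow> 0"
        by (rule Lim_null_comparison[rotated]) (use norm_a in auto)
      show "summable (\<lambda>n. norm (a (Suc n) - a n))"
      proof (rule summable_comparison_test')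
        \<comment> \<open>The 4 is 1 + 3: 1 from the newly added inner term, 3 from the bound on
          \<open>H n\<close>.\<close>
        show "summable (\<lambda>n. 4 * (sqrt (real (Suc n)) / real (Suc n) ^ 2))"
          by (intro summable_mult summable_sqrt_over_square)
        fix n :: nat
        let ?x = "real (Suc n)"
        let ?t = "v ^ Suc n / of_nat (Suc n) ^ p"
        have step: "H (Suc n) = H n + ?t"
          unfolding H_def by (subst sum.atLeastLessThan_Suc) auto
        have norm_t: "norm ?t \<le> 1 / ?x"
        proof -
          have "norm ?t = 1 / ?x ^ p"
            using v by (simp only: norm_divide norm_power norm_of_nat power_one)
          also have "\<dots> \<le> 1 / ?x ^ 1"
            using p by (intro divide_left_mono power_increasing) auto
          finally show ?thesis by simp
        qed
        have "of_nat (Suc n) \<noteq> (0 :: complex)" "of_nat (Suc (Suc n)) \<noteq> (0 :: complex)"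
          by (simp_all only: of_nat_eq_0_iff)
        moreover have "of_nat (Suc (Suc n)) = of_nat (Suc n) + (1 :: complex)"
          by simp
        \<comment> \<open>With x = n + 1 and new inner term t: (H + t)/(x + 1) - H/x = t/(x + 1) -
          H/(x (x + 1)).\<close>
        ultimately have "a (Suc n) - a n
            = ?t / of_nat (Suc (Suc n)) - H n / (of_nat (Suc n) * of_nat (Suc (Suc n)))"
          unfolding a_def step
          by (simp add: divide_simps del: of_nat_Suc) (simp add: algebra_simps)
        also have "norm \<dots> \<le> norm ?t / (?x + 1) + norm (H n) / (?x * (?x + 1))"
          by (rule order.trans[OF norm_triangle_ineq4])
            (simp add: norm_divide norm_mult add_ac del: power_Suc flip: of_nat_Suc)
        also have "\<dots> \<le> (1 / ?x) / ?x + 3 * sqrt ?x / (?x * ?x)"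
          using norm_t H_le[of n] by (intro add_mono frac_le mult_left_mono) auto
        also have "\<dots> \<le> sqrt ?x / (?x * ?x) + 3 * sqrt ?x / (?x * ?x)"
          by (intro add_right_mono) (simp add: divide_right_mono del: of_nat_Suc)
        also have "\<dots> = 4 * (sqrt ?x / ?x ^ 2)"
          by (simp add: power2_eq_square)
        finally show "norm (norm (a (Suc n) - a n)) \<le> 4 * (sqrt ?x / ?x ^ 2)"
          by simp
      qed
    qed
    then show ?thesis
      using True by (simp add: a_def)
  next
    case False
    show ?thesis
    proof (rule summable_comparison_test')
      show "summable (\<lambda>n. 3 * (sqrt (real (Suc n)) / real (Suc n) ^ 2))"
        by (intro summable_mult summable_sqrt_over_square)
      fix n :: nat
      have "norm (w ^ Suc n * (H n / of_nat (Suc n) ^ q)) = norm (H n) / real (Suc n) ^ q"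
        using w by (simp only: norm_divide norm_mult norm_power norm_of_nat power_one mult_1)
      also have "\<dots> \<le> 3 * sqrt (real (Suc n)) / real (Suc n) ^ 2"
        using q False H_le[of n] by (intro frac_le power_increasing) auto
      finally show "norm (w ^ Suc n * (H n / of_nat (Suc n) ^ q))
          \<le> 3 * (sqrt (real (Suc n)) / real (Suc n) ^ 2)"
        by simp
    qed
  qed
  then show ?thesis
    unfolding H_def .
qed

section \<open>Level-four terms and powers of the imaginary unit\<close>

lemma omega4_eq: "omega4 = \<i>"
proof -
  have "omega4 = exp (\<i> * of_real (pi / 2))"
    by (simp add: omega4_def mult_ac)
  also have "\<dots> = cis (pi / 2)"
    by (simp only: cis_conv_exp)
  finally show ?thesis
    by simp
qed

text \<open>Pulling the outer power out of the inner sum gives the shape of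
  \<open>summable_double_power_sum\<close>, with \<open>w = \<i> ^ r1\<close> and
  \<open>v = \<i> ^ r2\<close>.\<close>

lemma L4_term_eq:
  "L4_term q p r1 r2 n
     = (\<i> ^ r1) ^ n * ((\<Sum>k=1..<n. (\<i> ^ r2) ^ k / of_nat k ^ p) / of_nat n ^ q)"
  unfolding L4_term_def omega4_eq power_mult
  by (simp add: sum_distrib_left sum_divide_distrib mult.commute)

lemma summable_L4_term:
  assumes "p \<ge> 1" "q \<ge> 1" "q = 1 \<Longrightarrow> \<i> ^ r1 \<noteq> 1"
  shows "summable (\<lambda>n. L4_term q p r1 r2 (Suc n))"
  unfolding L4_term_eq
  by (rule summable_double_power_sum) (use assms in \<open>auto simp: norm_power\<close>)

lemma i_power_add_2: "(\<i> ^ (r + 2)) ^ n = (-1) ^ n * (\<i> ^ r) ^ n"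
proof -
  have "\<i> ^ (r + 2) = (-1) * \<i> ^ r"
    by simp
  then show ?thesis
    by (simp only: power_mult_distrib)
qed

lemma L4_term_outer_add_2: "L4_term q p (r1 + 2) r2 n = (-1) ^ n * L4_term q p r1 r2 n"
  by (simp only: L4_term_eq i_power_add_2 mult.assoc)

lemma sign_powr_three_halves:
  assumes "\<sigma> \<in> {1, -1}"
  shows "sign_powr \<sigma> (3/2) = (if \<sigma> = 1 then 1 else -\<i>)"
proof (cases "\<sigma> = 1")
  case True
  then show ?thesis
    by (simp add: sign_powr_def lam_def)
next
  case False
  then have "sign_powr \<sigma> (3/2) = exp (\<i> * of_real (3 / 2 * pi))"
    by (simp add: sign_powr_def lam_def mult_ac)
  also have "\<dots> = cis (3 / 2 * pi)"
    by (simp only: cis_conv_exp)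
  also have "\<dots> = -\<i>"
  proof -
    have "cis (3 / 2 * pi) = cis pi * cis (pi / 2)"
      by (simp only: cis_mult) (simp add: field_simps)
    then show ?thesis by simp
  qed
  finally show ?thesis
    using False by simp
qed

lemma i_power_lam_even:
  assumes "\<sigma> \<in> {1, -1}"
  shows "(\<i> ^ lam \<sigma>) ^ (2 * n) = of_int \<sigma> ^ n"
  using assms by (auto simp: lam_def power_mult)

text \<open>For \<sigma> = -1 an odd power of \<open>\<i>\<close> carries a stray factor
  \<open>\<i>\<close>, and \<open>sign_powr \<sigma> (3/2) = -\<i>\<close> is its inverse. This is
  the reason for the exponent 3/2 in the formulas.\<close>

lemma i_power_lam_odd:
  assumes "\<sigma> \<in> {1, -1}"
  shows "sign_powr \<sigma> (3/2) * (\<i> ^ lam \<sigma>) ^ (2 * n + 1) = of_int \<sigma> ^ n"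
  using assms by (auto simp: sign_powr_three_halves lam_def power_mult power_add)

section \<open>Selecting odd inner indices\<close>

text \<open>The weight \<open>1 - (-1) ^ k\<close> is 2 at odd \<open>k\<close> and 0 at even
  \<open>k\<close>. The surviving indices are 2j - 1 = 2 (j - 1/2) for j = 1, ..., m, whence the
  factor \<open>2 / 2 ^ p\<close>.\<close>

lemma sum_odd_eq_h_sum:
  assumes "\<sigma> \<in> {1, -1}"
  shows "sign_powr \<sigma> (3/2) *
      (\<Sum>k=1..<2*m+1. (1 - (-1) ^ k) * (\<i> ^ lam \<sigma>) ^ k / of_nat k ^ p)
    = 2 / 2 ^ p * of_real (h_sum m p \<sigma>)"
proof (induction m)
  case 0
  then show ?case by (simp add: h_sum_def)
next
  case (Suc m)
  let ?f = "\<lambda>k. (1 - (-1) ^ k) * (\<i> ^ lam \<sigma>) ^ k / of_nat k ^ p :: complex"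
  let ?s = "sign_powr \<sigma> (3/2)"
  \<comment> \<open>Two indices are added, but \<open>2 * m + 2\<close> is even and has weight
    0.\<close>
  have "(\<Sum>k=1..<2 * Suc m + 1. ?f k) = (\<Sum>k=1..<2 * m + 1. ?f k) + ?f (2 * m + 1)"
    by (simp add: sum.atLeastLessThan_Suc)
  then have "?s * (\<Sum>k=1..<2 * Suc m + 1. ?f k)
      = ?s * (\<Sum>k=1..<2 * m + 1. ?f k) + ?s * ?f (2 * m + 1)"
    by (simp only: distrib_left)
  also have "?s * ?f (2 * m + 1)
      = 2 * (?s * (\<i> ^ lam \<sigma>) ^ (2 * m + 1)) / of_nat (2 * m + 1) ^ p"
    by simp
  also have "\<dots> = 2 / 2 ^ p * of_real (of_int \<sigma> ^ m / (real (Suc m) - 1/2) ^ p)"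
  proof -
    have "of_nat (2 * m + 1) = (2 :: complex) * of_real (real (Suc m) - 1/2)"
      by simp
    then show ?thesis
      unfolding i_power_lam_odd[OF assms] by (simp only: power_mult_distrib) simp
  qed
  finally show ?case
    unfolding Suc.IH by (simp add: h_sum_def distrib_left)
qed

text \<open>The odd indices below \<open>2 * m\<close> and below \<open>2 * m + 1\<close> are the
  same, so one formula with \<open>h_sum m\<close> serves even outer indices (for S) and odd ones
  (for T). This accounts for h_n in S against h_{n-1} in T.\<close>

lemma L4_term_diff_inner:
  assumes "\<sigma> \<in> {1, -1}" "n \<in> {2 * m, 2 * m + 1}"
  shows "sign_powr \<sigma> (3/2) * (L4_term q p r (lam \<sigma>) n - L4_term q p r (lam \<sigma> + 2) n)
    = 2 / 2 ^ p * of_real (h_sum m p \<sigma>) * (\<i> ^ r) ^ n / of_nat n ^ q"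
proof -
  let ?f = "\<lambda>k. (1 - (-1) ^ k) * (\<i> ^ lam \<sigma>) ^ k / of_nat k ^ p :: complex"
  let ?s = "sign_powr \<sigma> (3/2)"
  have "(\<Sum>k=1..<2 * m. ?f k) = (\<Sum>k=1..<2 * m + 1. ?f k)"
    by (rule sum.mono_neutral_left) (auto simp: less_Suc_eq)
  then have eq: "(\<Sum>k=1..<n. ?f k) = (\<Sum>k=1..<2 * m + 1. ?f k)"
    using assms(2) by auto
  have "L4_term q p r (lam \<sigma>) n - L4_term q p r (lam \<sigma> + 2) n
      = (\<i> ^ r) ^ n * ((\<Sum>k=1..<n. ?f k) / of_nat n ^ q)"
  proof -
    have "?f k = (\<i> ^ lam \<sigma>) ^ k / of_nat k ^ p - (\<i> ^ (lam \<sigma> + 2)) ^ k / of_nat k ^ p" for k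
      by (simp only: i_power_add_2 left_diff_distrib diff_divide_distrib mult_1)
    then show ?thesis
      by (simp only: L4_term_eq sum_subtractf diff_divide_distrib right_diff_distrib)
  qed
  then have "?s * (L4_term q p r (lam \<sigma>) n - L4_term q p r (lam \<sigma> + 2) n)
      = (?s * (\<Sum>k=1..<2 * m + 1. ?f k)) * (\<i> ^ r) ^ n / of_nat n ^ q"
    unfolding eq by simp
  then show ?thesis
    unfolding sum_odd_eq_h_sum[OF assms(1)] .
qed

text \<open>The 4 collects one factor 2 from each of the two parity selections;
  \<open>p, q \<ge> 1\<close> keeps the natural-number subtraction from truncating.\<close>

lemma two_power_weight:
  assumes "p \<ge> 1" "q \<ge> 1"
  shows "(2 :: complex) ^ (p + q - 2) * 4 = 2 ^ p * 2 ^ q"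
  using assms by (cases p; cases q) (simp_all add: power_add)

section \<open>Termwise identities for T and S\<close>

text \<open>The term of index n + 1 in T has denominator base n + 1/2 = (2n + 1)/2, so it matches
  outer index \<open>2 * n + 1\<close>. The inner factor 2 is the outer weight
  \<open>1 - (-1) ^ (2 * n + 1)\<close>.\<close>

lemma T_term_eq_L4_terms:
  assumes "p \<ge> 1" "q \<ge> 1" "\<sigma>1 \<in> {1, -1}" "\<sigma>2 \<in> {1, -1}"
  shows "complex_of_real (T_term p q \<sigma>1 \<sigma>2 (Suc n)) =
    2 ^ (p + q - 2) * sign_powr \<sigma>1 (3/2) * sign_powr \<sigma>2 (3/2) *
    (2 * (L4_term q p (lam \<sigma>2) (lam \<sigma>1) (2 * n + 1) - L4_term q p (lam \<sigma>2) (lam \<sigma>1 + 2) (2 * n + 1)))"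
proof -
  let ?D = "L4_term q p (lam \<sigma>2) (lam \<sigma>1) (2 * n + 1) - L4_term q p (lam \<sigma>2) (lam \<sigma>1 + 2) (2 * n + 1)"
  have half: "of_nat (2 * n + 1) = (2 :: complex) * of_real (real (Suc n) - 1/2)"
    by simp
  have "2 ^ (p + q - 2) * sign_powr \<sigma>1 (3/2) * sign_powr \<sigma>2 (3/2) * (2 * ?D)
      = 2 ^ (p + q - 2) * 2 * sign_powr \<sigma>2 (3/2) * (sign_powr \<sigma>1 (3/2) * ?D)"
    by (simp only: mult_ac)
  also have "sign_powr \<sigma>1 (3/2) * ?D
      = 2 / 2 ^ p * of_real (h_sum n p \<sigma>1) * (\<i> ^ lam \<sigma>2) ^ (2 * n + 1) / of_nat (2 * n + 1) ^ q"
    by (rule L4_term_diff_inner) (use assms in auto)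
  also have "2 ^ (p + q - 2) * 2 * sign_powr \<sigma>2 (3/2) * \<dots>
      = (2 ^ (p + q - 2) * 4) / 2 ^ p * of_real (h_sum n p \<sigma>1) *
        (sign_powr \<sigma>2 (3/2) * (\<i> ^ lam \<sigma>2) ^ (2 * n + 1)) / of_nat (2 * n + 1) ^ q"
    by simp
  also have "\<dots> = 2 ^ q * of_real (h_sum n p \<sigma>1) * of_int \<sigma>2 ^ n
      / (2 ^ q * of_real (real (Suc n) - 1/2) ^ q)"
    unfolding two_power_weight[OF assms(1,2)] i_power_lam_odd[OF assms(4)] half power_mult_distrib by simp
  also have "\<dots> = of_real (T_term p q \<sigma>1 \<sigma>2 (Suc n))"
    by (simp add: T_term_def)
  finally show ?thesis ..
qed

lemma S_term_eq_L4_terms: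
  assumes "p \<ge> 1" "q \<ge> 1" "\<sigma>1 \<in> {1, -1}" "\<sigma>2 \<in> {1, -1}"
  shows "complex_of_real (S_term p q \<sigma>1 \<sigma>2 (Suc n)) =
    2 ^ (p + q - 2) * sign_powr \<sigma>1 (3/2) * of_int \<sigma>2 *
    (2 * (L4_term q p (lam \<sigma>2) (lam \<sigma>1) (2 * Suc n) - L4_term q p (lam \<sigma>2) (lam \<sigma>1 + 2) (2 * Suc n)))"
proof -
  let ?D = "L4_term q p (lam \<sigma>2) (lam \<sigma>1) (2 * Suc n) - L4_term q p (lam \<sigma>2) (lam \<sigma>1 + 2) (2 * Suc n)"
  \<comment> \<open>The outer power at \<open>2 * Suc n\<close> yields
    \<open>\<sigma>2 ^ Suc n\<close>, one factor more than in \<open>S_term\<close>; the prefactor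
    \<open>of_int \<sigma>2\<close> cancels it.\<close>
  have sq: "of_int \<sigma>2 * of_int \<sigma>2 ^ Suc n = (of_int \<sigma>2 ^ n :: complex)"
    using assms(4) by auto
  have "2 ^ (p + q - 2) * sign_powr \<sigma>1 (3/2) * of_int \<sigma>2 * (2 * ?D)
      = 2 ^ (p + q - 2) * 2 * of_int \<sigma>2 * (sign_powr \<sigma>1 (3/2) * ?D)"
    by (simp only: mult_ac)
  also have "sign_powr \<sigma>1 (3/2) * ?D
      = 2 / 2 ^ p * of_real (h_sum (Suc n) p \<sigma>1) * (\<i> ^ lam \<sigma>2) ^ (2 * Suc n) / of_nat (2 * Suc n) ^ q"
    by (rule L4_term_diff_inner) (use assms in auto)
  also have "2 ^ (p + q - 2) * 2 * of_int \<sigma>2 * \<dots>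
      = (2 ^ (p + q - 2) * 4) / 2 ^ p * of_real (h_sum (Suc n) p \<sigma>1) *
        (of_int \<sigma>2 * (\<i> ^ lam \<sigma>2) ^ (2 * Suc n)) / of_nat (2 * Suc n) ^ q"
    by simp
  also have "\<dots> = 2 ^ q * of_real (h_sum (Suc n) p \<sigma>1) * of_int \<sigma>2 ^ n
      / (2 ^ q * of_nat (Suc n) ^ q)"
    unfolding two_power_weight[OF assms(1,2)] i_power_lam_even[OF assms(4)] sq of_nat_mult power_mult_distrib by simp
  also have "\<dots> = of_real (S_term p q \<sigma>1 \<sigma>2 (Suc n))"
    by (simp add: S_term_def)
  finally show ?thesis ..
qed

section \<open>Summation of the termwise identities\<close>

theorem theorem3p11:
  fixes p q :: nat and \<sigma>1 \<sigma>2 :: int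
  assumes "p \<ge> 1" and "q \<ge> 1"
    and "\<sigma>1 \<in> {1, -1}" and "\<sigma>2 \<in> {1, -1}"
    and "(q, \<sigma>2) \<noteq> (1, 1)"
  shows "summable (\<lambda>n. T_term p q \<sigma>1 \<sigma>2 (Suc n))
    \<and> summable (\<lambda>n. S_term p q \<sigma>1 \<sigma>2 (Suc n))
    \<and> (\<forall>r1 \<in> {lam \<sigma>2, lam \<sigma>2 + 2}. \<forall>r2 \<in> {lam \<sigma>1, lam \<sigma>1 + 2}.
         summable (\<lambda>n. L4_term q p r1 r2 (Suc n)))
    \<and> complex_of_real (T_sum p q \<sigma>1 \<sigma>2) =
         2 ^ (p + q - 2) * sign_powr \<sigma>1 (3/2) * sign_powr \<sigma>2 (3/2) *
         (L4 q p (lam \<sigma>2) (lam \<sigma>1) - L4 q p (lam \<sigma>2) (lam \<sigma>1 + 2)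
          - L4 q p (lam \<sigma>2 + 2) (lam \<sigma>1) + L4 q p (lam \<sigma>2 + 2) (lam \<sigma>1 + 2))
    \<and> complex_of_real (S_sum p q \<sigma>1 \<sigma>2) =
         2 ^ (p + q - 2) * sign_powr \<sigma>1 (3/2) * of_int \<sigma>2 *
         (L4 q p (lam \<sigma>2) (lam \<sigma>1) - L4 q p (lam \<sigma>2) (lam \<sigma>1 + 2)
          + L4 q p (lam \<sigma>2 + 2) (lam \<sigma>1) - L4 q p (lam \<sigma>2 + 2) (lam \<sigma>1 + 2))"
proof -
  let ?r1 = "lam \<sigma>2" and ?r2 = "lam \<sigma>1"
  \<comment> \<open>If \<open>q = 1\<close>, then \<sigma>2 = -1 and \<open>r1\<close> is 1 or 3, so
    \<open>\<i> ^ r1\<close> is \<open>\<i>\<close> or \<open>-\<i>\<close>. This makes Dirichlet's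
    test applicable.\<close>
  have "\<i> ^ r1 \<noteq> 1" if "q = 1" "r1 \<in> {?r1, ?r1 + 2}" for r1
  proof -
    have "\<sigma>2 = -1"
      using assms(4,5) that(1) by auto
    then show ?thesis
      using that(2) by (auto simp: lam_def complex_eq_iff)
  qed
  then have summable_L4: "summable (\<lambda>n. L4_term q p r1 r2 (Suc n))"
    if "r1 \<in> {?r1, ?r1 + 2}" for r1 r2
    using assms(1,2) that by (intro summable_L4_term) auto
  then have L4_sums: "(\<lambda>n. L4_term q p r1 r2 (Suc n)) sums L4 q p r1 r2"
    if "r1 \<in> {?r1, ?r1 + 2}" for r1 r2
    using that unfolding L4_def by (blast intro: summable_sums)
  define D where "D n = L4_term q p ?r1 ?r2 n - L4_term q p ?r1 (?r2 + 2) n" for n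
  \<comment> \<open>Since the series start at 1, the n-th block of two holds the odd index first and
    the even index second.\<close>
  have pair: "(\<Sum>i=n*2..<n*2+2. F (Suc i)) = F (2 * n + 1) + F (2 * Suc n)"
    for F :: "nat \<Rightarrow> complex" and n
    by (simp add: numeral_2_eq_2 mult.commute)

  have "(\<lambda>n. (1 - (-1) ^ Suc n) * D (Suc n)) sums
      (L4 q p ?r1 ?r2 - L4 q p ?r1 (?r2 + 2) - L4 q p (?r1 + 2) ?r2 + L4 q p (?r1 + 2) (?r2 + 2))"
    (is "_ sums ?T")
  proof -
    have "(\<lambda>n. L4_term q p ?r1 ?r2 (Suc n) - L4_term q p ?r1 (?r2 + 2) (Suc n)
        - L4_term q p (?r1 + 2) ?r2 (Suc n) + L4_term q p (?r1 + 2) (?r2 + 2) (Suc n)) sums ?T"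
      by (intro sums_add sums_diff L4_sums) auto
    then show ?thesis
      unfolding L4_term_outer_add_2 D_def by (simp add: algebra_simps)
  qed
  \<comment> \<open>Grouping preserves the sum of a series already known to converge. In each block
    the even index has weight 0 and the odd one weight 2.\<close>
  from sums_group[OF this, of 2] have "(\<lambda>n. 2 * D (2 * n + 1)) sums ?T"
    unfolding pair[of "\<lambda>n. (1 - (-1) ^ n) * D n"] by simp
  then have T: "(\<lambda>n. complex_of_real (T_term p q \<sigma>1 \<sigma>2 (Suc n))) sums
      (2 ^ (p + q - 2) * sign_powr \<sigma>1 (3/2) * sign_powr \<sigma>2 (3/2) * ?T)"
    unfolding T_term_eq_L4_terms[OF assms(1-4)] D_def by (rule sums_mult)

  have "(\<lambda>n. (1 + (-1) ^ Suc n) * D (Suc n)) sums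
      (L4 q p ?r1 ?r2 - L4 q p ?r1 (?r2 + 2) + L4 q p (?r1 + 2) ?r2 - L4 q p (?r1 + 2) (?r2 + 2))"
    (is "_ sums ?S")
  proof -
    have "(\<lambda>n. L4_term q p ?r1 ?r2 (Suc n) - L4_term q p ?r1 (?r2 + 2) (Suc n)
        + L4_term q p (?r1 + 2) ?r2 (Suc n) - L4_term q p (?r1 + 2) (?r2 + 2) (Suc n)) sums ?S"
      by (intro sums_add sums_diff L4_sums) auto
    then show ?thesis
      unfolding L4_term_outer_add_2 D_def by (simp add: algebra_simps)
  qed
  \<comment> \<open>Now the odd index vanishes and the even one has weight 2.\<close>
  from sums_group[OF this, of 2] have "(\<lambda>n. 2 * D (2 * Suc n)) sums ?S"
    unfolding pair[of "\<lambda>n. (1 + (-1) ^ n) * D n"] by simp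
  then have S: "(\<lambda>n. complex_of_real (S_term p q \<sigma>1 \<sigma>2 (Suc n))) sums
      (2 ^ (p + q - 2) * sign_powr \<sigma>1 (3/2) * of_int \<sigma>2 * ?S)"
    unfolding S_term_eq_L4_terms[OF assms(1-4)] D_def by (rule sums_mult)

  \<comment> \<open>Taking real parts turns the complex sums into convergence of the real series for
    T and S, so this is a consequence of the level-four convergence rather than a separate
    estimate.\<close>
  have real_sums: "summable f \<and> complex_of_real (suminf f) = s"
    if "(\<lambda>n. complex_of_real (f n)) sums s" for f s
  proof
    show "summable f"
      using sums_Re[OF that] by (simp add: sums_iff)
    then show "complex_of_real (suminf f) = s"
      using that by (simp add: suminf_of_real sums_iff)
  qed
  show ?thesis
    using real_sums[OF T] real_sums[OF S] summable_L4 unfolding T_sum_def S_sum_def by auto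
qed

end
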